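(* Let $G=(Q,\Sigma,\delta,I)$ be a discrete-event system with secret states $Q_S\subseteq Q$, non-secret states $Q_{NS}\subseteq Q$, and projection $P\colon\Sigma^*\to\Sigma_o^*$. Let $@\notin\Sigma$ be a new observable event, let $q_s,q_{ns}\notin Q$ be two new distinct states, and let $G'=(Q\cup\{q_s,q_{ns}\},\Sigma\cup\{@\},\delta',I)$, where $\delta'$ consists of all transitions of $\delta$ together with the transitions $(q,@,q_s)$ for every $q\in Q_S$ and $(q,@,q_{ns})$ for every $q\in Q_{NS}$. Let $P'\colon(\Sigma\cup\{@\})^*\to(\Sigma_o\cup\{@\})^*$ be the projection, $Q_S'=\{q_s\}$, and $Q_{NS}'=Q_S\cup Q_{NS}\cup\{q_{ns}\}$. Then, for any $K\in\mathbb{N}\cup\{\infty\}$, $G$ is current-state opaque with respect to $Q_S,Q_{NS},P$ if and only if $G'$ is $K$-step opaque with respect to $Q_S',Q_{NS}',P'$.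
   Context: An NFA over a finite nonempty alphabet $\Sigma$ is $(Q,\Sigma,\delta,I)$ with finite state set $Q$, initial states $I\subseteq Q$, and $\delta\colon Q\times\Sigma\to 2^Q$, extended in the usual way to $2^Q\times\Sigma^*$; a transition $(p,a,q)$ means $q\in\delta(p,a)$. $L(G)=\{w\mid\delta(I,w)\ne\emptyset\}$. A discrete-event system (DES) is an NFA together with a partition of $\Sigma$ into observable events $\Sigma_o$ and unobservable events $\Sigma_{uo}$. A projection is the morphism on strings erasing the unobservable events and keeping the observable ones. $K$-step opacity, for $K\in\mathbb{N}\cup\{\infty\}$: $G$ is $K$-step opaque w.r.t. secret states $Q_S$, non-secret states $Q_{NS}$, and $P$ if for every $st\in L(G)$ with $|P(t)|\le K$ and $\delta(\delta(I,s)\cap Q_S,t)\neq\emptyset$, there is $s't'\in L(G)$ such that $P(s)=P(s')$, $P(t)=P(t')$, and $\delta(\delta(I,s')\cap Q_{NS},t')\neq\emptyset$. Current-state opacity is $0$-step opacity. States that are in neither $Q_S$ nor $Q_{NS}$ are allowed. *)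

theory Defs
  imports Main "HOL-Library.Extended_Nat"
begin

record ('q, 'a) nfa =
  states :: "'q set"
  alphabet :: "'a set"
  trans :: "'q \<Rightarrow> 'a \<Rightarrow> 'q set"
  init :: "'q set"

text \<open>Only the values of \<^const>\<open>trans\<close> on \<^const>\<open>states\<close> and \<^const>\<open>alphabet\<close>
  are constrained; its values elsewhere are junk and never matter below, because words are
  required to be over the alphabet.\<close>

definition is_nfa :: "('q, 'a, 'z) nfa_scheme \<Rightarrow> bool" where
  "is_nfa G \<longleftrightarrow>
     finite (states G) \<and> finite (alphabet G) \<and> alphabet G \<noteq> {} \<and> init G \<subseteq> states G \<and>
     (\<forall>p\<in>states G. \<forall>a\<in>alphabet G. trans G p a \<subseteq> states G)"

primrec trans_star :: "('q, 'a, 'z) nfa_scheme \<Rightarrow> 'q set \<Rightarrow> 'a list \<Rightarrow> 'q set" where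
  "trans_star G X [] = X"
| "trans_star G X (a # w) = trans_star G (\<Union>p\<in>X. trans G p a) w"

definition language :: "('q, 'a, 'z) nfa_scheme \<Rightarrow> 'a list set" where
  "language G = {w \<in> lists (alphabet G). trans_star G (init G) w \<noteq> {}}"

record ('q, 'a) des = "('q, 'a) nfa" +
  observable :: "'a set"
  unobservable :: "'a set"

text \<open>Either block of the partition may be empty.\<close>

definition is_des :: "('q, 'a, 'z) des_scheme \<Rightarrow> bool" where
  "is_des G \<longleftrightarrow> is_nfa G \<and> observable G \<union> unobservable G = alphabet G \<and>
     observable G \<inter> unobservable G = {}"

definition projection :: "('q, 'a, 'z) des_scheme \<Rightarrow> 'a list \<Rightarrow> 'a list" where
  "projection G w = filter (\<lambda>a. a \<in> observable G) w"

definition k_step_opaque ::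
  "enat \<Rightarrow> ('q, 'a, 'z) des_scheme \<Rightarrow> 'q set \<Rightarrow> 'q set \<Rightarrow> ('a list \<Rightarrow> 'a list) \<Rightarrow> bool" where
  "k_step_opaque K G QS QNS P \<longleftrightarrow>
     (\<forall>s t. s @ t \<in> language G \<and> enat (length (P t)) \<le> K \<and>
            trans_star G (trans_star G (init G) s \<inter> QS) t \<noteq> {} \<longrightarrow>
        (\<exists>s' t'. s' @ t' \<in> language G \<and> P s = P s' \<and> P t = P t' \<and>
            trans_star G (trans_star G (init G) s' \<inter> QNS) t' \<noteq> {}))"

definition current_state_opaque ::
  "('q, 'a, 'z) des_scheme \<Rightarrow> 'q set \<Rightarrow> 'q set \<Rightarrow> ('a list \<Rightarrow> 'a list) \<Rightarrow> bool" where
  "current_state_opaque G QS QNS P \<longleftrightarrow> k_step_opaque 0 G QS QNS P"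

text \<open>The automaton \<open>G'\<close> obtained from \<open>G\<close> by adding the observable event \<open>e\<close> (written \<open>@\<close>
  informally) and the states \<open>qs\<close> and \<open>qns\<close>. Old transitions are restricted to the carriers of
  \<open>G\<close>, so junk values of \<^const>\<open>trans\<close> at \<open>qs\<close>, \<open>qns\<close> or \<open>e\<close> are not inherited.\<close>

definition extend_des ::
  "('q, 'a) des \<Rightarrow> 'q set \<Rightarrow> 'q set \<Rightarrow> 'a \<Rightarrow> 'q \<Rightarrow> 'q \<Rightarrow> ('q, 'a) des" where
  "extend_des G QS QNS e qs qns =
     \<lparr> states = states G \<union> {qs, qns},
       alphabet = alphabet G \<union> {e},
       trans = (\<lambda>p a. {q. p \<in> states G \<and> a \<in> alphabet G \<and> q \<in> trans G p a
                        \<or> p \<in> QS \<and> a = e \<and> q = qs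
                        \<or> p \<in> QNS \<and> a = e \<and> q = qns}),
       init = init G,
       observable = observable G \<union> {e},
       unobservable = unobservable G \<rparr>"

lemma is_des_extend_des:
  assumes "is_des G" and "e \<notin> alphabet G"
  shows "is_des (extend_des G QS QNS e qs qns)"
  using assms by (auto simp: is_des_def is_nfa_def extend_des_def)

end

theory Submission
  imports Defs
begin

text \<open>In \<open>G'\<close> the states \<open>qs\<close> and \<open>qns\<close> have no outgoing transitions and are entered only by \<open>@\<close>.
  Hence a run of \<open>G'\<close> from the initial states that ends in one of them reads \<open>x @\<close> with \<open>x\<close> a word
  over the old alphabet, and it ends in \<open>qs\<close> (\<open>qns\<close>) exactly if \<open>x\<close> leads to \<open>QS\<close> (\<open>QNS\<close>) in \<open>G\<close>.
  The only continuation of a visit to \<open>qs\<close> is the empty one, so the bound \<open>K\<close> plays no role, and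
  for current-state opacity it likewise suffices to consider empty continuations.\<close>

lemma trans_star_empty [simp]: "trans_star G {} w = {}"
  by (induction w) simp_all

lemma trans_star_append: "trans_star G X (u @ v) = trans_star G (trans_star G X u) v"
  by (induction u arbitrary: X) simp_all

lemma trans_star_subset_states:
  assumes "is_nfa G" "X \<subseteq> states G" "w \<in> lists (alphabet G)"
  shows "trans_star G X w \<subseteq> states G"
  using assms(2,3)
proof (induction w arbitrary: X)
  case (Cons a w)
  then have "(\<Union>p\<in>X. trans G p a) \<subseteq> states G"
    using assms(1) unfolding is_nfa_def by fastforce
  with Cons show ?case by simp
qed simp

text \<open>A continuation \<open>t\<close> with \<open>K = 0\<close> contains no observable event,
  so it can be matched by the empty continuation. Membership in the language then follows from the
  nonempty intersection.\<close>

lemma current_state_opaque_iff: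
  "current_state_opaque G QS QNS (projection G) \<longleftrightarrow>
     (\<forall>s\<in>lists (alphabet G). trans_star G (init G) s \<inter> QS \<noteq> {} \<longrightarrow>
        (\<exists>s'\<in>lists (alphabet G). projection G s = projection G s' \<and>
           trans_star G (init G) s' \<inter> QNS \<noteq> {}))"
  (is "_ \<longleftrightarrow> ?R")
proof
  assume opaque: "current_state_opaque G QS QNS (projection G)"
  show ?R
  proof (intro ballI impI)
    fix s assume "s \<in> lists (alphabet G)" "trans_star G (init G) s \<inter> QS \<noteq> {}"
    then have "s @ [] \<in> language G \<and> enat (length (projection G [])) \<le> 0 \<and>
        trans_star G (trans_star G (init G) s \<inter> QS) [] \<noteq> {}"
      by (auto simp: language_def projection_def zero_enat_def)
    then obtain s' t' where "s' @ t' \<in> language G" "projection G s = projection G s'"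
      "trans_star G (trans_star G (init G) s' \<inter> QNS) t' \<noteq> {}"
      using opaque unfolding current_state_opaque_def k_step_opaque_def by blast
    \<comment> \<open>The word \<open>t'\<close> may be nonempty, but the empty set has only empty
      successors, so nonemptiness after \<open>t'\<close> carries back to its start.\<close>
    moreover from this have "trans_star G (init G) s' \<inter> QNS \<noteq> {}"
      by (metis trans_star_empty)
    ultimately show "\<exists>s'\<in>lists (alphabet G). projection G s = projection G s' \<and>
           trans_star G (init G) s' \<inter> QNS \<noteq> {}"
      by (auto simp: language_def)
  qed
next
  assume R: ?R
  show "current_state_opaque G QS QNS (projection G)"
    unfolding current_state_opaque_def k_step_opaque_def
  proof (intro allI impI, elim conjE)
    fix s t
    assume st: "s @ t \<in> language G" "enat (length (projection G t)) \<le> 0"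
      "trans_star G (trans_star G (init G) s \<inter> QS) t \<noteq> {}"
    have "trans_star G (init G) s \<inter> QS \<noteq> {}"
      using st(3) by (metis trans_star_empty)
    moreover have "s \<in> lists (alphabet G)"
      using st(1) by (simp add: language_def)
    ultimately obtain s' where s': "s' \<in> lists (alphabet G)" "projection G s = projection G s'"
      "trans_star G (init G) s' \<inter> QNS \<noteq> {}"
      using R by blast
    moreover have "s' @ [] \<in> language G"
      using s' by (auto simp: language_def)
    moreover have "projection G t = projection G []"
      using st(2) by (simp add: projection_def zero_enat_def)
    ultimately show "\<exists>s' t'. s' @ t' \<in> language G \<and> projection G s = projection G s' \<and>
        projection G t = projection G t' \<and>
        trans_star G (trans_star G (init G) s' \<inter> QNS) t' \<noteq> {}"
      by (metis trans_star.simps(1))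
  qed
qed

locale extended_des =
  fixes G :: "('q, 'a) des" and QS QNS :: "'q set" and e :: 'a and qs qns :: 'q
  assumes des: "is_des G"
    and QS: "QS \<subseteq> states G" and QNS: "QNS \<subseteq> states G"
    and fresh: "e \<notin> alphabet G" "qs \<notin> states G" "qns \<notin> states G" "qs \<noteq> qns"
begin

abbreviation G' :: "('q, 'a) des" where
  "G' \<equiv> extend_des G QS QNS e qs qns"

lemma init_subset: "init G \<subseteq> states G" and nfa: "is_nfa G"
  using des by (simp_all add: is_des_def is_nfa_def)

text \<open>Without \<open>e\<close> no new transition fires, and the reached sets stay inside
  \<open>states G\<close>, where the restriction of the old transitions to the carriers has no
  effect.\<close>

lemma trans_star_extend:
  assumes "X \<subseteq> states G" "w \<in> lists (alphabet G)"
  shows "trans_star G' X w = trans_star G X w"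
  using assms
proof (induction w arbitrary: X)
  case (Cons a w)
  then have "(\<Union>p\<in>X. trans G' p a) = (\<Union>p\<in>X. trans G p a)"
    using fresh by (fastforce simp: extend_des_def)
  moreover have "(\<Union>p\<in>X. trans G p a) \<subseteq> states G"
    using Cons.prems nfa unfolding is_nfa_def by fastforce
  ultimately show ?case using Cons by simp
qed simp

text \<open>After \<open>x\<close> the run is still the one of \<open>G\<close>, and
  \<open>e\<close> enables only the two new families of transitions. The set reached by
  \<open>x\<close> may meet both \<open>QS\<close> and \<open>QNS\<close>, hence a union.\<close>

lemma trans_star_snoc_e:
  assumes "x \<in> lists (alphabet G)"
  shows "trans_star G' (init G) (x @ [e]) =
    (if trans_star G (init G) x \<inter> QS \<noteq> {} then {qs} else {}) \<union>
    (if trans_star G (init G) x \<inter> QNS \<noteq> {} then {qns} else {})"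
proof -
  have step: "trans_star G' X [e] =
      (if X \<inter> QS \<noteq> {} then {qs} else {}) \<union> (if X \<inter> QNS \<noteq> {} then {qns} else {})" for X
    using fresh by (auto simp: extend_des_def)
  show ?thesis
    unfolding trans_star_append trans_star_extend[OF init_subset assms] by (rule step)
qed

text \<open>Every transition of \<open>G'\<close> starts in \<open>states G\<close>,
  \<open>QS\<close> or \<open>QNS\<close>, and none of these contains \<open>qs\<close> or
  \<open>qns\<close>.\<close>

lemma trans_star_final:
  assumes "X \<subseteq> {qs, qns}" "trans_star G' X w \<noteq> {}"
  shows "w = []"
proof (cases w)
  case (Cons a v)
  have "(\<Union>p\<in>X. trans G' p a) = {}"
    using assms(1) fresh QS QNS by (auto simp: extend_des_def)
  with Cons assms(2) show ?thesis by simp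
qed

lemma word_with_e:
  assumes "w \<in> lists (alphabet G')" "e \<in> set w" "trans_star G' (init G) w \<noteq> {}"
  obtains x where "x \<in> lists (alphabet G)" "w = x @ [e]"
proof -
  \<comment> \<open>Cutting at the first occurrence of \<open>e\<close> makes \<open>x\<close> a
    word over the old alphabet.\<close>
  obtain x y where w: "w = x @ e # y" "e \<notin> set x"
    using split_list_first[OF assms(2)] by blast
  have x: "x \<in> lists (alphabet G)"
    using assms(1) w by (auto simp: extend_des_def)
  have "trans_star G' (trans_star G' (init G) (x @ [e])) y \<noteq> {}"
    using assms(3) w by (simp add: trans_star_append)
  then have "y = []"
    by (rule trans_star_final[rotated]) (auto simp: trans_star_snoc_e[OF x])
  with x w that show ?thesis by simp
qed

text \<open>A word free of \<open>e\<close> keeps the run inside \<open>states G\<close>, away from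
  \<open>qs\<close> and \<open>qns\<close>.\<close>

lemma word_to_final:
  assumes "w \<in> lists (alphabet G')" "trans_star G' (init G) w \<inter> {qs, qns} \<noteq> {}"
  obtains x where "x \<in> lists (alphabet G)" "w = x @ [e]"
proof -
  have "e \<in> set w"
  proof (rule ccontr)
    assume "e \<notin> set w"
    then have w: "w \<in> lists (alphabet G)"
      using assms(1) by (auto simp: extend_des_def)
    then have "trans_star G' (init G) w \<subseteq> states G"
      using trans_star_extend[OF init_subset w] trans_star_subset_states[OF nfa init_subset w] by simp
    with assms(2) fresh show False by auto
  qed
  then show ?thesis using word_with_e assms that by blast
qed

lemma projection_extend:
  assumes "x \<in> lists (alphabet G)"
  shows "projection G' x = projection G x"
  using assms fresh by (auto simp: projection_def extend_des_def intro!: filter_cong)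

text \<open>Since the final \<open>e\<close> cancels, \<open>x\<close> and \<open>y\<close> look
  alike in \<open>G\<close> exactly if \<open>x @ [e]\<close> and \<open>y @ [e]\<close> look alike
  in \<open>G'\<close>.\<close>

lemma projection_snoc_e:
  assumes "x \<in> lists (alphabet G)"
  shows "projection G' (x @ [e]) = projection G x @ [e]"
  using projection_extend[OF assms] by (simp add: projection_def extend_des_def)

lemma snoc_e_in_lists: "x \<in> lists (alphabet G) \<Longrightarrow> x @ [e] \<in> lists (alphabet G')"
  by (auto simp: extend_des_def)

lemma init_extend [simp]: "init G' = init G"
  by (simp add: extend_des_def)

text \<open>Both directions transfer witnesses along the correspondence between \<open>x\<close> in
  \<open>G\<close> and \<open>x @ [e]\<close> in \<open>G'\<close>.\<close>

theorem k_step_opaque_extend_iff: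
  "k_step_opaque K G' {qs} (QS \<union> QNS \<union> {qns}) (projection G') \<longleftrightarrow>
   current_state_opaque G QS QNS (projection G)"
proof
  assume opaque: "k_step_opaque K G' {qs} (QS \<union> QNS \<union> {qns}) (projection G')"
  show "current_state_opaque G QS QNS (projection G)"
    unfolding current_state_opaque_iff
  proof (intro ballI impI)
    fix s assume s: "s \<in> lists (alphabet G)" "trans_star G (init G) s \<inter> QS \<noteq> {}"
    \<comment> \<open>The empty continuation has projection of length 0, which is within every bound
      \<open>K\<close>.\<close>
    have "(s @ [e]) @ [] \<in> language G' \<and> enat (length (projection G' [])) \<le> K \<and>
        trans_star G' (trans_star G' (init G') (s @ [e]) \<inter> {qs}) [] \<noteq> {}"
      using s trans_star_snoc_e[OF s(1)] snoc_e_in_lists[OF s(1)]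
      by (simp add: language_def projection_def flip: zero_enat_def)
    then obtain s' t' where s't': "s' @ t' \<in> language G'"
      "projection G' (s @ [e]) = projection G' s'"
      "trans_star G' (trans_star G' (init G) s' \<inter> (QS \<union> QNS \<union> {qns})) t' \<noteq> {}"
      using opaque unfolding k_step_opaque_def init_extend by blast
    have ne: "trans_star G' (init G) s' \<inter> (QS \<union> QNS \<union> {qns}) \<noteq> {}"
      using s't'(3) by (metis trans_star_empty)
    \<comment> \<open>As \<open>e\<close> is observable, the matching word must read it too, so its
      non-secret visit cannot be to an old state.\<close>
    have "e \<in> set (projection G' s')"
      using s't'(2) projection_snoc_e[OF s(1)] by (metis in_set_conv_decomp)
    then have "e \<in> set s'"
      by (simp add: projection_def)
    moreover have "s' \<in> lists (alphabet G')"
      using s't'(1) by (auto simp: language_def)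
    ultimately obtain x where x: "x \<in> lists (alphabet G)" "s' = x @ [e]"
      using ne by (elim word_with_e) blast+
    have "projection G s = projection G x"
      using s't'(2) by (simp add: x projection_snoc_e s(1))
    moreover have "trans_star G (init G) x \<inter> QNS \<noteq> {}"
    proof -
      \<comment> \<open>The set reached by \<open>x @ [e]\<close> lies in \<open>{qs, qns}\<close>.
        It meets the non-secret states, to which \<open>qs\<close> does not belong, so it contains
        \<open>qns\<close>, which forces \<open>x\<close> to lead to \<open>QNS\<close>.\<close>
      have "qs \<notin> QS \<union> QNS \<union> {qns}"
        using fresh QS QNS by auto
      with ne show ?thesis
        unfolding x(2) trans_star_snoc_e[OF x(1)] by (auto split: if_splits)
    qed
    ultimately show "\<exists>s'\<in>lists (alphabet G). projection G s = projection G s' \<and>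
        trans_star G (init G) s' \<inter> QNS \<noteq> {}"
      using x(1) by blast
  qed
next
  assume opaque: "current_state_opaque G QS QNS (projection G)"
  show "k_step_opaque K G' {qs} (QS \<union> QNS \<union> {qns}) (projection G')"
    unfolding k_step_opaque_def init_extend
  proof (intro allI impI, elim conjE)
    fix s t
    assume st: "s @ t \<in> language G'" "trans_star G' (trans_star G' (init G) s \<inter> {qs}) t \<noteq> {}"
    have t: "t = []"
      using st(2) by (rule trans_star_final[rotated]) auto
    have qs: "qs \<in> trans_star G' (init G) s"
      using st(2) t by auto
    have "s \<in> lists (alphabet G')"
      using st(1) by (auto simp: language_def)
    then obtain x where x: "x \<in> lists (alphabet G)" "s = x @ [e]"
      using qs by (elim word_to_final) blast+
    \<comment> \<open>Because \<open>qs\<close> differs from \<open>qns\<close>, it can only come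
      from the \<open>QS\<close> part of the union.\<close>
    have "trans_star G (init G) x \<inter> QS \<noteq> {}"
      using qs fresh unfolding x(2) trans_star_snoc_e[OF x(1)] by (auto split: if_splits)
    then obtain y where y: "y \<in> lists (alphabet G)" "projection G x = projection G y"
      "trans_star G (init G) y \<inter> QNS \<noteq> {}"
      using opaque x(1) unfolding current_state_opaque_iff by blast
    \<comment> \<open>The word \<open>y @ [e]\<close> with empty continuation is the required
      witness, its non-secret visit being to \<open>qns\<close>.\<close>
    have "qns \<in> trans_star G' (init G) (y @ [e])"
      using y by (simp add: trans_star_snoc_e)
    then have "(y @ [e]) @ [] \<in> language G'"
      "trans_star G' (trans_star G' (init G) (y @ [e]) \<inter> (QS \<union> QNS \<union> {qns})) [] \<noteq> {}"
      using snoc_e_in_lists[OF y(1)] by (auto simp: language_def)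
    moreover have "projection G' s = projection G' (y @ [e])"
      using x y by (simp add: projection_snoc_e)
    ultimately show "\<exists>s' t'. s' @ t' \<in> language G' \<and> projection G' s = projection G' s' \<and>
        projection G' t = projection G' t' \<and>
        trans_star G' (trans_star G' (init G) s' \<inter> (QS \<union> QNS \<union> {qns})) t' \<noteq> {}"
      using t by blast
  qed
qed

end

theorem theorem4:
  fixes G G' :: "('q, 'a) des"
    and QS QNS :: "'q set"
    and e :: 'a
    and qs qns :: 'q
    and K :: enat
  assumes "is_des G"
    and "QS \<subseteq> states G"
    and "QNS \<subseteq> states G"
    and "e \<notin> alphabet G"
    and "qs \<notin> states G"
    and "qns \<notin> states G"
    and "qs \<noteq> qns"
    and "G' = extend_des G QS QNS e qs qns"
  shows "current_state_opaque G QS QNS (projection G) \<longleftrightarrow>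
         k_step_opaque K G' {qs} (QS \<union> QNS \<union> {qns}) (projection G')"
proof -
  interpret extended_des G QS QNS e qs qns
    using assms by unfold_locales
  show ?thesis
    unfolding assms(8) by (rule k_step_opaque_extend_iff[symmetric])
qed

end
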